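(* Let $\Omega\subset\mathbb H$ be a bounded axially symmetric s-domain and let $\mathbf i\in\mathbb S^2$ be fixed. There exist constants $K_\Omega,M_\Omega,K'_\Omega,M'_\Omega>0$ (independent of $f$) such that: 1. if $f\in\mathcal A(\Omega)$ then $$\int_{\Omega_{\mathbf i}}|f|_{\Omega_{\mathbf i}}|^2\rho\,d\sigma_{\mathbf i}\le K_\Omega\,\|f\|^2_{\mathcal A(\Omega)};$$ if $f\in\mathcal A_\rho(\Omega_{\mathbf i})$ then $$\|f\|^2_{\mathcal A(\Omega)}\le M_\Omega\int_{\Omega_{\mathbf i}}|f|_{\Omega_{\mathbf i}}|^2\rho\,d\sigma_{\mathbf i};$$ 2. if $f\in\mathcal A(\Omega_{\mathbf i})$ then $$\int_\Omega|f|^2\delta\,d\mu\le K'_\Omega\,\|f\|^2_{\mathcal A(\Omega_{\mathbf i})};$$ if $f\in\mathcal A_\delta(\Omega)$ then $$\|f\|^2_{\mathcal A(\Omega_{\mathbf i})}\le M'_\Omega\int_\Omega|f|^2\delta\,d\mu.$$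
   Context: $\mathbb H$ is the algebra of real quaternions; $q\in\mathbb H$ is written $q=q_0+\underline q$ with $q_0$ real and $\underline q$ purely imaginary. $\mathbb S^2$ is the set of purely imaginary quaternions of modulus $1$, and for $\mathbf i\in\mathbb S^2$, $\mathbb C(\mathbf i)=\{x+y\mathbf i: x,y\in\mathbb R\}$, $\Omega_{\mathbf i}=\Omega\cap\mathbb C(\mathbf i)$. A domain $\Omega\subseteq\mathbb H$ is an s-domain if $\Omega\cap\mathbb R\neq\emptyset$ and $\Omega_{\mathbf i}$ is a domain in $\mathbb C(\mathbf i)$ for all $\mathbf i\in\mathbb S^2$. $\Omega$ is axially symmetric if $x+\mathbf i y\in\Omega$ implies $x+\mathbf j y\in\Omega$ for all $\mathbf j\in\mathbb S^2$. $\mathcal{SR}(\Omega)$ is the set of (left) slice regular functions on $\Omega$: real differentiable $f:\Omega\to\mathbb H$ such that for every $\mathbf i\in\mathbb S^2$, $\left(\frac{\partial}{\partial x}+\mathbf i\frac{\partial}{\partial y}\right)f|_{\Omega_{\mathbf i}}(x+y\mathbf i)=0$ on $\Omega_{\mathbf i}$. $d\mu$ is Lebesgue measure on $\mathbb H\cong\mathbb R^4$ and $d\sigma_{\mathbf i}(x+\mathbf i y)=dx\,dy$. Weights: $\rho(x+\mathbf i y)=y^2$ on $\Omega_{\mathbf i}$, and $\delta(q)=1/|\underline q|^2$ on $\Omega$ (defined almost everywhere). Spaces: $\mathcal A(\Omega)=\{f\in\mathcal{SR}(\Omega):\|f\|^2_{\mathcal A(\Omega)}:=\int_\Omega|f|^2d\mu<\infty\}$;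 $\mathcal A(\Omega_{\mathbf i})=\{f\in\mathcal{SR}(\Omega):\|f\|^2_{\mathcal A(\Omega_{\mathbf i})}:=\int_{\Omega_{\mathbf i}}|f|_{\Omega_{\mathbf i}}|^2d\sigma_{\mathbf i}<\infty\}$; $\mathcal A_\rho(\Omega_{\mathbf i})=\{f\in\mathcal{SR}(\Omega):\int_{\Omega_{\mathbf i}}|f|_{\Omega_{\mathbf i}}|^2\rho\,d\sigma_{\mathbf i}<\infty\}$; $\mathcal A_\delta(\Omega)=\{f\in\mathcal{SR}(\Omega):\int_\Omega|f|^2\delta\,d\mu<\infty\}$. *)

theory Defs
  imports "HOL-Analysis.Analysis"
begin

text \<open>A quaternion \<open>q\<close> is the pair of its real part \<open>fst q\<close> and
  its purely imaginary part \<open>snd q\<close>, so that topology, modulus, real derivatives and Lebesgue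
  measure on \<open>\<real>\<^sup>4\<close> are those of the product type.  Multiplication is the Hamilton product in
  scalar/vector form.\<close>

type_synonym quat = "real \<times> (real ^ 3)"

definition qmult :: "quat \<Rightarrow> quat \<Rightarrow> quat"  (infixl "\<odot>" 70) where
  "p \<odot> q = (fst p * fst q - snd p \<bullet> snd q,
            fst p *\<^sub>R snd q + fst q *\<^sub>R snd p + cross3 (snd p) (snd q))"

definition qreal :: "real \<Rightarrow> quat" where
  "qreal x = (x, 0)"

definition qIm :: "quat \<Rightarrow> quat" where
  "qIm q = (0, snd q)"

definition imag_sphere :: "quat set" where
  "imag_sphere = {q. fst q = 0 \<and> norm q = 1}"

definition slice_pt :: "quat \<Rightarrow> real \<Rightarrow> real \<Rightarrow> quat" where
  "slice_pt i x y = qreal x + y *\<^sub>R i"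

definition slice_plane :: "quat \<Rightarrow> quat set" where
  "slice_plane i = {slice_pt i x y | x y. True}"

definition slice :: "quat set \<Rightarrow> quat \<Rightarrow> quat set" where
  "slice \<Omega> i = \<Omega> \<inter> slice_plane i"

lemma qmult_assoc: "p \<odot> q \<odot> r = p \<odot> (q \<odot> r)"
  by (simp add: qmult_def cross3_def vec_eq_iff forall_3 inner_vec_def sum_3 algebra_simps)

lemma qmult_imag_sphere_self: "i \<in> imag_sphere \<Longrightarrow> i \<odot> i = qreal (- 1)"
  by (auto simp: qmult_def imag_sphere_def qreal_def norm_prod_def cross3_def vec_eq_iff
      forall_3 dot_square_norm)

lemma norm_qmult: "norm (p \<odot> q) = norm p * norm q"
proof -
  have "(norm (p \<odot> q))\<^sup>2 = (norm p * norm q)\<^sup>2"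
    unfolding power_mult_distrib power2_norm_eq_inner
    by (simp add: qmult_def cross3_def inner_prod_def inner_vec_def sum_3 power2_eq_square
        algebra_simps)
  then show ?thesis
    by (simp add: power2_eq_iff_nonneg)
qed

definition s_domain :: "quat set \<Rightarrow> bool" where
  "s_domain \<Omega> \<longleftrightarrow>
     open \<Omega> \<and> connected \<Omega> \<and> \<Omega> \<noteq> {} \<and>
     \<Omega> \<inter> range qreal \<noteq> {} \<and>
     (\<forall>i\<in>imag_sphere.
        openin (top_of_set (slice_plane i)) (slice \<Omega> i) \<and>
        connected (slice \<Omega> i) \<and> slice \<Omega> i \<noteq> {})"

definition axially_symmetric :: "quat set \<Rightarrow> bool" where
  "axially_symmetric \<Omega> \<longleftrightarrow>
     (\<forall>i\<in>imag_sphere. \<forall>x y. slice_pt i x y \<in> \<Omega> \<longrightarrow>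
        (\<forall>j\<in>imag_sphere. slice_pt j x y \<in> \<Omega>))"

text \<open>Functions on \<open>\<Omega>\<close> are total functions whose values outside \<open>\<Omega>\<close> are irrelevant.  Since
  \<open>f\<close> is real differentiable on the open set \<open>\<Omega>\<close>, both partial derivatives below exist.\<close>

definition slice_regular :: "quat set \<Rightarrow> (quat \<Rightarrow> quat) set" where
  "slice_regular \<Omega> =
     {f. f differentiable_on \<Omega> \<and>
         (\<forall>i\<in>imag_sphere. \<forall>x y. slice_pt i x y \<in> \<Omega> \<longrightarrow>
            vector_derivative (\<lambda>s. f (slice_pt i s y)) (at x) +
            i \<odot> vector_derivative (\<lambda>t. f (slice_pt i x t)) (at y) = 0)}"

text \<open>The measure \<open>d\<sigma>\<^sub>i(x + iy) = dx dy\<close> on the plane \<open>slice_plane i\<close>, viewed as a measure on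
  all quaternions.\<close>

definition slice_measure :: "quat \<Rightarrow> quat measure" where
  "slice_measure i = distr (lborel :: (real \<times> real) measure) borel (\<lambda>(x, y). slice_pt i x y)"

definition weight_rho :: "quat \<Rightarrow> real" where
  "weight_rho q = (norm (qIm q))\<^sup>2"

lemma weight_rho_slice_pt: "i \<in> imag_sphere \<Longrightarrow> weight_rho (slice_pt i x y) = y\<^sup>2"
  by (auto simp: weight_rho_def qIm_def slice_pt_def qreal_def imag_sphere_def norm_prod_def
      power_mult_distrib)

text \<open>On the real axis, a null set, \<open>weight_delta\<close> has the value \<open>1 / 0 = 0\<close>.\<close>

definition weight_delta :: "quat \<Rightarrow> real" where
  "weight_delta q = 1 / (norm (qIm q))\<^sup>2"

text \<open>The squared norms are extended nonnegative reals, so that they are meaningful without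
  assuming integrability.\<close>

definition sqnorm :: "quat set \<Rightarrow> (quat \<Rightarrow> quat) \<Rightarrow> ennreal" where
  "sqnorm \<Omega> f = (\<integral>\<^sup>+q\<in>\<Omega>. ennreal ((norm (f q))\<^sup>2) \<partial>lborel)"

definition sqnorm_delta :: "quat set \<Rightarrow> (quat \<Rightarrow> quat) \<Rightarrow> ennreal" where
  "sqnorm_delta \<Omega> f = (\<integral>\<^sup>+q\<in>\<Omega>. ennreal ((norm (f q))\<^sup>2 * weight_delta q) \<partial>lborel)"

definition sqnorm_slice :: "quat set \<Rightarrow> quat \<Rightarrow> (quat \<Rightarrow> quat) \<Rightarrow> ennreal" where
  "sqnorm_slice \<Omega> i f = (\<integral>\<^sup>+q\<in>slice \<Omega> i. ennreal ((norm (f q))\<^sup>2) \<partial>slice_measure i)"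

definition sqnorm_slice_rho :: "quat set \<Rightarrow> quat \<Rightarrow> (quat \<Rightarrow> quat) \<Rightarrow> ennreal" where
  "sqnorm_slice_rho \<Omega> i f =
     (\<integral>\<^sup>+q\<in>slice \<Omega> i. ennreal ((norm (f q))\<^sup>2 * weight_rho q) \<partial>slice_measure i)"

definition bergman :: "quat set \<Rightarrow> (quat \<Rightarrow> quat) set" where
  "bergman \<Omega> = {f \<in> slice_regular \<Omega>. sqnorm \<Omega> f < \<infinity>}"

definition bergman_delta :: "quat set \<Rightarrow> (quat \<Rightarrow> quat) set" where
  "bergman_delta \<Omega> = {f \<in> slice_regular \<Omega>. sqnorm_delta \<Omega> f < \<infinity>}"

definition bergman_slice :: "quat set \<Rightarrow> quat \<Rightarrow> (quat \<Rightarrow> quat) set" where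
  "bergman_slice \<Omega> i = {f \<in> slice_regular \<Omega>. sqnorm_slice \<Omega> i f < \<infinity>}"

definition bergman_slice_rho :: "quat set \<Rightarrow> quat \<Rightarrow> (quat \<Rightarrow> quat) set" where
  "bergman_slice_rho \<Omega> i = {f \<in> slice_regular \<Omega>. sqnorm_slice_rho \<Omega> i f < \<infinity>}"

end

theory Submission
  imports Defs "HOL-Complex_Analysis.Conformal_Mappings"
begin

text \<open>The representation formula \<open>f (x + j y) = A + j B\<close>, with \<open>A\<close> and \<open>B\<close> independent of
  \<open>j\<close>, and the parallelogram law show that \<open>|f (x + j y)|\<^sup>2 + |f (x - j y)|\<^sup>2\<close> does not depend on
  \<open>j\<close>.  Averaging \<open>|f|\<^sup>2\<close> over conjugate points therefore makes it radial in the imaginary part, and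
  polar coordinates in \<open>\<real>\<^sup>3\<close> yield both comparisons as identities, with the factor \<open>2 \<pi>\<close>.\<close>

section \<open>Reflection and polar coordinates for Lebesgue measure\<close>

lemma nn_integral_lborel_uminus:
  fixes g :: "'a::euclidean_space \<Rightarrow> ennreal"
  assumes [measurable]: "g \<in> borel_measurable borel"
  shows "(\<integral>\<^sup>+x. g (- x) \<partial>lborel) = (\<integral>\<^sup>+x. g x \<partial>lborel)"
proof -
  have "lborel = distr lborel borel (uminus :: 'a \<Rightarrow> 'a)"
    using lborel_affine[of "-1" "0::'a"] by (simp add: density_1)
  then have "(\<integral>\<^sup>+x. g x \<partial>lborel) = (\<integral>\<^sup>+x. g x \<partial>distr lborel borel (uminus :: 'a \<Rightarrow> 'a))"
    by (rule arg_cong)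
  also have "\<dots> = (\<integral>\<^sup>+x. g (- x) \<partial>lborel)"
    by (rule nn_integral_distr) measurable
  finally show ?thesis by simp
qed

text \<open>A measure finite on the half-lines \<open>{..r}\<close> is determined by its values
  there. For the distribution of the norm these values are volumes of balls, a constant times
  \<open>r ^ DIM('a)\<close> for nonnegative \<open>r\<close>, and the density is the derivative of
  this volume.\<close>

lemma distr_norm_lborel:
  "distr lborel borel (norm :: 'a::euclidean_space \<Rightarrow> real) =
   density lborel (\<lambda>r. ennreal (DIM('a) * unit_ball_vol DIM('a) * r ^ (DIM('a) - 1)) *
     indicator {0..} r)" (is "?D = ?N")
proof (rule measure_eqI_generator_eq[where E = "range atMost" and \<Omega> = UNIV
      and A = "\<lambda>n. {..real n}"])
  show "Int_stable (range (atMost :: real \<Rightarrow> _))"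
    by (auto simp: Int_stable_def)
  show "sets ?D = sigma_sets UNIV (range atMost)" "sets ?N = sigma_sets UNIV (range atMost)"
    by (simp_all add: borel_eq_atMost)
  have D: "emeasure ?D {..r} = emeasure lborel (cball (0::'a) r)" for r
    by (subst emeasure_distr) (auto simp: vimage_def cball_def)
  show "emeasure ?D {..real n} \<noteq> \<infinity>" for n
    by (simp add: D emeasure_cball)
  fix X :: "real set" assume "X \<in> range atMost"
  then obtain r where X: "X = {..r}" by auto
  let ?n = "DIM('a)" and ?V = "unit_ball_vol DIM('a)"
  have N: "emeasure ?N {..r} = (\<integral>\<^sup>+s. ennreal (?n * ?V * s ^ (?n - 1)) * indicator {0..r} s \<partial>lborel)"
    by (subst emeasure_density) (auto intro!: nn_integral_cong split: split_indicator)
  show "emeasure ?D X = emeasure ?N X"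
  proof (cases "r \<ge> 0")
    case True
    \<comment> \<open>The boundary term at 0 vanishes because the dimension is positive.\<close>
    have "emeasure ?N {..r} = ?V * r ^ ?n - ?V * 0 ^ ?n"
      unfolding N using True
      by (intro nn_integral_FTC_Icc)
        (auto intro!: derivative_eq_intros unit_ball_vol_nonneg mult_nonneg_nonneg
          simp flip: has_real_derivative_iff_has_vector_derivative)
    with True show ?thesis
      by (simp add: X D emeasure_cball)
  next
    case False
    then show ?thesis unfolding X D N by simp
  qed
qed (auto simp: real_arch_simple)

lemma nn_integral_norm_lborel:
  fixes g :: "real \<Rightarrow> ennreal"
  assumes [measurable]: "g \<in> borel_measurable borel"
  shows "(\<integral>\<^sup>+x. g (norm x) \<partial>(lborel :: 'a::euclidean_space measure)) =
    (\<integral>\<^sup>+r. ennreal (DIM('a) * unit_ball_vol DIM('a) * r ^ (DIM('a) - 1)) * indicator {0..} r * g r \<partial>lborel)"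
proof -
  have "(\<integral>\<^sup>+x. g (norm x) \<partial>(lborel :: 'a measure)) =
      (\<integral>\<^sup>+r. g r \<partial>distr lborel borel (norm :: 'a \<Rightarrow> real))"
    by (rule nn_integral_distr[symmetric]) measurable
  also have "\<dots> = (\<integral>\<^sup>+r. ennreal (DIM('a) * unit_ball_vol DIM('a) * r ^ (DIM('a) - 1)) *
      indicator {0..} r * g r \<partial>lborel)"
    unfolding distr_norm_lborel by (rule nn_integral_density) measurable
  finally show ?thesis .
qed

lemma nn_integral_even_half:
  fixes g :: "real \<Rightarrow> ennreal"
  assumes [measurable]: "g \<in> borel_measurable borel"
  shows "(\<integral>\<^sup>+y. g y \<partial>lborel) = (\<integral>\<^sup>+y. indicator {0..} y * (g y + g (- y)) \<partial>lborel)"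
proof -
  have "(\<integral>\<^sup>+y. indicator {0..} y * (g y + g (- y)) \<partial>lborel) =
      (\<integral>\<^sup>+y. indicator {0..} y * g y \<partial>lborel) + (\<integral>\<^sup>+y. indicator {0..} y * g (- y) \<partial>lborel)"
    by (subst nn_integral_add[symmetric]) (auto simp: distrib_left)
  also have "(\<integral>\<^sup>+y. indicator {0..} y * g (- y) \<partial>lborel) = (\<integral>\<^sup>+y. indicator {..0} y * g y \<partial>lborel)"
    by (subst (2) nn_integral_lborel_uminus[symmetric])
      (auto intro!: nn_integral_cong split: split_indicator)
  also have "(\<integral>\<^sup>+y. indicator {0..} y * g y \<partial>lborel) + \<dots> =
      (\<integral>\<^sup>+y. indicator {0..} y * g y + indicator {..0} y * g y \<partial>lborel)"
    by (rule nn_integral_add[symmetric]) auto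
  \<comment> \<open>The two closed half-lines overlap only in the point 0, a null set.\<close>
  also have "\<dots> = (\<integral>\<^sup>+y. g y \<partial>lborel)"
    by (intro nn_integral_cong_AE eventually_mono[OF AE_lborel_singleton[of 0]])
      (auto split: split_indicator)
  finally show ?thesis by simp
qed

section \<open>Iterated integrals over a slice and over all quaternions\<close>

lemma slice_pt_measurable[measurable]:
  assumes "f \<in> borel_measurable M" "g \<in> borel_measurable M"
  shows "(\<lambda>x. slice_pt i (f x) (g x)) \<in> borel_measurable M"
  using assms unfolding slice_pt_def qreal_def by measurable

lemma nn_integral_slice_measure:
  assumes [measurable]: "F \<in> borel_measurable borel"
  shows "(\<integral>\<^sup>+q. F q \<partial>slice_measure i) = (\<integral>\<^sup>+x. \<integral>\<^sup>+y. F (slice_pt i x y) \<partial>lborel \<partial>lborel)"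
proof -
  have [measurable]: "(\<lambda>p. slice_pt i (fst p) (snd p)) \<in> borel_measurable borel"
    unfolding slice_pt_def qreal_def
    by (intro borel_measurable_continuous_onI continuous_intros)
  have "(\<integral>\<^sup>+q. F q \<partial>slice_measure i) = (\<integral>\<^sup>+p. F (slice_pt i (fst p) (snd p)) \<partial>lborel)"
    unfolding slice_measure_def case_prod_beta' by (rule nn_integral_distr) simp_all
  also have "\<dots> = (\<integral>\<^sup>+x. \<integral>\<^sup>+y. F (slice_pt i x y) \<partial>lborel \<partial>lborel)"
    unfolding lborel_prod[symmetric]
    by (subst lborel.nn_integral_fst[symmetric]) (simp_all, measurable)
  finally show ?thesis .
qed

text \<open>The sum over a pair of conjugate points being constant on each sphere, the integral over
  the two-sphere factors out of the polar decomposition of the imaginary part.\<close>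

lemma nn_integral_quat_slice:
  fixes F :: "quat \<Rightarrow> ennreal"
  assumes [measurable]: "F \<in> borel_measurable borel"
    and sph: "\<And>x v. F (x, v) + F (x, - v) = F (slice_pt i x (norm v)) + F (slice_pt i x (- norm v))"
  shows "(\<integral>\<^sup>+q. F q \<partial>lborel) =
    ennreal (2 * pi) * (\<integral>\<^sup>+x. \<integral>\<^sup>+y. F (slice_pt i x y) * ennreal (y\<^sup>2) \<partial>lborel \<partial>lborel)"
proof -
  define H where "H x y = F (slice_pt i x y) + F (slice_pt i x (- y))" for x y
  have [measurable]: "H x \<in> borel_measurable borel" for x
    unfolding H_def by measurable
  \<comment> \<open>The factor 2 on both sides lets the values at \<open>v\<close> and
    \<open>- v\<close> be summed instead of averaged; being neither zero nor infinite, it can be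
    cancelled afterwards.\<close>
  have inner: "2 * (\<integral>\<^sup>+v. F (x, v) \<partial>lborel) =
      2 * (ennreal (2 * pi) * (\<integral>\<^sup>+y. F (slice_pt i x y) * ennreal (y\<^sup>2) \<partial>lborel))" for x
  proof -
    have "2 * (\<integral>\<^sup>+v. F (x, v) \<partial>lborel) = (\<integral>\<^sup>+v. F (x, v) \<partial>lborel) + (\<integral>\<^sup>+v. F (x, - v) \<partial>lborel)"
      by (subst nn_integral_lborel_uminus) (simp_all add: mult_2)
    also have "\<dots> = (\<integral>\<^sup>+v. H x (norm (v :: real ^ 3)) \<partial>lborel)"
      by (subst nn_integral_add[symmetric]) (auto simp: sph H_def)
    \<comment> \<open>The constant is 3 times the volume 4 pi / 3 of the unit ball, that is, the
      area of the unit sphere.\<close>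
    also have "\<dots> = (\<integral>\<^sup>+r. ennreal (4 * pi) * (indicator {0..} r * (H x r * ennreal (r\<^sup>2))) \<partial>lborel)"
      by (subst nn_integral_norm_lborel)
        (auto simp: unit_ball_vol_3 ennreal_mult' mult_ac intro!: nn_integral_cong)
    also have "\<dots> = ennreal (4 * pi) * (\<integral>\<^sup>+r. indicator {0..} r * (H x r * ennreal (r\<^sup>2)) \<partial>lborel)"
      by (rule nn_integral_cmult) measurable
    \<comment> \<open>Since \<open>y\<^sup>2\<close> is even, the two summands of \<open>H\<close>
      account for the two halves of the integral over the whole line.\<close>
    also have "(\<integral>\<^sup>+r. indicator {0..} r * (H x r * ennreal (r\<^sup>2)) \<partial>lborel) =
        (\<integral>\<^sup>+y. F (slice_pt i x y) * ennreal (y\<^sup>2) \<partial>lborel)"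
      by (subst nn_integral_even_half[of "\<lambda>y. F (slice_pt i x y) * ennreal (y\<^sup>2)"])
        (auto simp: H_def distrib_right)
    also have "ennreal (4 * pi) = 2 * ennreal (2 * pi)"
      using ennreal_mult'[of 2 "2 * pi"] by simp
    finally show ?thesis by (simp add: mult.assoc)
  qed
  have "(\<integral>\<^sup>+q. F q \<partial>lborel) = (\<integral>\<^sup>+x. \<integral>\<^sup>+v. F (x, v) \<partial>lborel \<partial>lborel)"
    by (subst lborel.nn_integral_fst) (simp_all add: lborel_prod)
  also have "\<dots> = (\<integral>\<^sup>+x. ennreal (2 * pi) * (\<integral>\<^sup>+y. F (slice_pt i x y) * ennreal (y\<^sup>2) \<partial>lborel) \<partial>lborel)"
    using inner by (intro nn_integral_cong) (simp add: ennreal_mult_cancel_left)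
  also have "\<dots> = ennreal (2 * pi) * (\<integral>\<^sup>+x. \<integral>\<^sup>+y. F (slice_pt i x y) * ennreal (y\<^sup>2) \<partial>lborel \<partial>lborel)"
    by (rule nn_integral_cmult) measurable
  finally show ?thesis .
qed

section \<open>Algebra of the Hamilton product and points of slices\<close>

lemma bounded_bilinear_qmult: "bounded_bilinear (\<odot>)"
proof -
  have "bilinear (\<odot>)"
    by (auto simp: bilinear_def linear_iff qmult_def cross3_def vec_eq_iff forall_3 inner_vec_def
        sum_3 algebra_simps)
  then show ?thesis
    by (simp add: bilinear_conv_bounded_bilinear)
qed

interpretation qmult: bounded_bilinear "(\<odot>)"
  by (rule bounded_bilinear_qmult)

text \<open>This is the polarised form of the multiplicativity of the norm: left multiplication by a
  unit is orthogonal.\<close>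

lemma inner_qmult_qmult: "(j \<odot> p) \<bullet> (j \<odot> q) = (norm j)\<^sup>2 * (p \<bullet> q)"
  unfolding power2_norm_eq_inner
  by (simp add: qmult_def cross3_def inner_prod_def inner_vec_def sum_3 power2_eq_square
      algebra_simps)

lemma qmult_qreal: "qreal x \<odot> q = x *\<^sub>R q"
  by (simp add: qmult_def qreal_def prod_eq_iff cross3_def vec_eq_iff forall_3)

lemma qmult_imag_sphere_left: "i \<in> imag_sphere \<Longrightarrow> i \<odot> (i \<odot> q) = - q"
  by (simp add: qmult_assoc[symmetric] qmult_imag_sphere_self qmult_qreal)

lemma uminus_imag_sphere: "i \<in> imag_sphere \<Longrightarrow> - i \<in> imag_sphere"
  by (simp add: imag_sphere_def)

lemma slice_pt_uminus: "slice_pt (- i) x y = slice_pt i x (- y)"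
  by (simp add: slice_pt_def)

lemma slice_pt_0: "slice_pt i x 0 = qreal x"
  by (simp add: slice_pt_def)

lemma exists_slice_pt: "\<exists>j\<in>imag_sphere. (x, v) = slice_pt j x (norm v)"
proof (cases "v = 0")
  case True
  \<comment> \<open>A real point lies on every slice, so any imaginary unit serves.\<close>
  have "(0, axis 1 1) \<in> imag_sphere" by (simp add: imag_sphere_def norm_prod_def norm_axis_1)
  with True show ?thesis by (intro bexI[of _ "(0, axis 1 1)"]) (simp_all add: slice_pt_def qreal_def)
next
  case False
  then have "(0, v /\<^sub>R norm v) \<in> imag_sphere" by (simp add: imag_sphere_def norm_prod_def)
  moreover have "(x, v) = slice_pt (0, v /\<^sub>R norm v) x (norm v)"
    using False by (simp add: slice_pt_def qreal_def)
  ultimately show ?thesis by blast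
qed

lemma axially_symmetric_slice_pt:
  assumes "axially_symmetric \<Omega>" "i \<in> imag_sphere" "j \<in> imag_sphere"
  shows "slice_pt i x y \<in> \<Omega> \<longleftrightarrow> slice_pt j x y \<in> \<Omega>"
  using assms unfolding axially_symmetric_def by blast

section \<open>Slices as complex planes, and the representation formula\<close>

definition slice_param :: "quat \<Rightarrow> complex \<Rightarrow> quat" where
  "slice_param i z = slice_pt i (Re z) (Im z)"

lemma bounded_linear_slice_param: "bounded_linear (slice_param i)"
  unfolding linear_conv_bounded_linear[symmetric]
  by (rule linearI) (auto simp: slice_param_def slice_pt_def qreal_def algebra_simps prod_eq_iff)

lemma continuous_on_slice_param: "continuous_on S (slice_param i)"
  by (rule bounded_linear.continuous_on[OF bounded_linear_slice_param continuous_on_id])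

text \<open>Real differentiability supplies a differential, and the slice equation forces its value
  at \<open>i\<close> to be \<open>i\<close> times its value \<open>d\<close> at 1. Along the slice
  it is therefore determined by \<open>d\<close> alone, as a complex derivative would be.\<close>

lemma slice_regular_has_derivative:
  assumes f: "f \<in> slice_regular \<Omega>" and "open \<Omega>" and i: "i \<in> imag_sphere"
    and z: "slice_param i z \<in> \<Omega>"
  shows "\<exists>d. ((\<lambda>w. f (slice_param i w)) has_derivative (\<lambda>h. slice_param i h \<odot> d)) (at z)"
proof -
  have "f differentiable at (slice_param i z)"
    using f z at_within_open[OF z \<open>open \<Omega>\<close>] by (simp add: slice_regular_def differentiable_on_def) metis
  then obtain f' where f': "(f has_derivative f') (at (slice_param i z))"
    by (auto simp: differentiable_def)
  then interpret f': bounded_linear f' by (rule has_derivative_bounded_linear)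
  have fz: "((\<lambda>w. f (slice_param i w)) has_derivative (\<lambda>h. f' (slice_param i h))) (at z)"
    by (rule has_derivative_compose[OF bounded_linear_imp_has_derivative[OF bounded_linear_slice_param] f'])
  have "((\<lambda>s. f (slice_pt i s (Im z))) has_vector_derivative f' (qreal 1)) (at (Re z))"
    unfolding has_vector_derivative_def f'.scaleR[symmetric]
    by (rule has_derivative_compose[where f = "\<lambda>s. slice_pt i s (Im z)" and g = f and g' = f'])
      (use f' in \<open>auto intro!: derivative_eq_intros
        simp: slice_param_def slice_pt_def qreal_def zero_prod_def\<close>)
  moreover have "((\<lambda>t. f (slice_pt i (Re z) t)) has_vector_derivative f' i) (at (Im z))"
    unfolding has_vector_derivative_def f'.scaleR[symmetric]
    by (rule has_derivative_compose[where f = "slice_pt i (Re z)" and g = f and g' = f'])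
      (use f' in \<open>auto intro!: derivative_eq_intros simp: slice_param_def slice_pt_def[abs_def]\<close>)
  moreover have "vector_derivative (\<lambda>s. f (slice_pt i s (Im z))) (at (Re z)) +
      i \<odot> vector_derivative (\<lambda>t. f (slice_pt i (Re z) t)) (at (Im z)) = 0"
    using f z i unfolding slice_regular_def slice_param_def by blast
  ultimately have "f' (qreal 1) + i \<odot> f' i = 0"
    by (simp add: vector_derivative_at)
  then have "i \<odot> f' (qreal 1) + i \<odot> (i \<odot> f' i) = 0"
    by (metis qmult.add_right qmult.zero_right)
  then have i': "f' i = i \<odot> f' (qreal 1)"
    by (simp add: qmult_imag_sphere_left[OF i])
  have "f' (slice_param i h) = slice_param i h \<odot> f' (qreal 1)" for h
  proof -
    have "slice_param i h = Re h *\<^sub>R qreal 1 + Im h *\<^sub>R i"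
      by (simp add: slice_param_def slice_pt_def qreal_def)
    then show ?thesis
      by (simp add: f'.add f'.scaleR i' qmult.add_left qmult.scaleR_left qmult_qreal)
  qed
  with fz show ?thesis by (intro exI[of _ "f' (qreal 1)"]) simp
qed

text \<open>For every \<open>p\<close> the map \<open>q \<mapsto> q \<bullet> p + \<i> (q \<bullet> (j \<odot> p))\<close> turns left
  multiplication by \<open>j\<close> into multiplication by \<open>\<i>\<close>, so that no splitting basis is needed.\<close>

lemma slice_identity_principle:
  assumes "open S" "connected S" and j: "j \<in> imag_sphere"
    and g: "\<And>z. z \<in> S \<Longrightarrow> \<exists>d. (g has_derivative (\<lambda>h. slice_param j h \<odot> d)) (at z)"
    and zero: "\<And>x. complex_of_real x \<in> S \<Longrightarrow> g x = 0"
    and x0: "complex_of_real x0 \<in> S" and w: "w \<in> S"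
  shows "g w = 0"
proof -
  have nj: "norm j = 1" using j by (simp add: imag_sphere_def)
  define L where "L p q = Complex (q \<bullet> p) (q \<bullet> (j \<odot> p))" for p q
  have L: "bounded_linear (L p)" for p
    unfolding linear_conv_bounded_linear[symmetric]
    by (rule linearI) (auto simp: L_def complex_eq_iff inner_add_left)
  have Lj: "L p (slice_param j h \<odot> q) = L p q * h" for p h q
  proof -
    have 1: "(j \<odot> q) \<bullet> (j \<odot> p) = q \<bullet> p"
      by (simp add: inner_qmult_qmult nj)
    \<comment> \<open>Left multiplication by an imaginary unit is skew: applied to both arguments of
      the inner product, it turns \<open>j \<odot> p\<close> into \<open>- p\<close>.\<close>
    have 2: "(j \<odot> q) \<bullet> p = - (q \<bullet> (j \<odot> p))"
      using inner_qmult_qmult[of j q "j \<odot> p"]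
      by (simp add: nj qmult_imag_sphere_left[OF j])
    show ?thesis
      by (simp add: L_def complex_eq_iff slice_param_def slice_pt_def qmult.add_left
          qmult.scaleR_left qmult_qreal inner_add_left 1 2)
  qed
  have "L p (g w) = 0" for p
  proof (rule analytic_continuation[where f = "\<lambda>z. L p (g z)" and U = "S \<inter> \<real>"])
    show "(\<lambda>z. L p (g z)) holomorphic_on S"
      unfolding holomorphic_on_open[OF \<open>open S\<close>]
    proof
      fix z assume "z \<in> S"
      then obtain d where "(g has_derivative (\<lambda>h. slice_param j h \<odot> d)) (at z)" using g by blast
      then have "((\<lambda>z. L p (g z)) has_derivative (\<lambda>h. L p (slice_param j h \<odot> d))) (at z)"
        by (rule bounded_linear.has_derivative[OF L])
      then show "\<exists>f'. ((\<lambda>z. L p (g z)) has_field_derivative f') (at z)"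
        unfolding Lj has_field_derivative_def by blast
    qed
    \<comment> \<open>Small real translates of \<open>x0\<close> stay in the open set
      \<open>S\<close>, so the real points accumulate there.\<close>
    show "complex_of_real x0 islimpt S \<inter> \<real>"
      unfolding islimpt_approachable
    proof (intro allI impI)
      fix e :: real assume "e > 0"
      obtain r where r: "r > 0" "ball (complex_of_real x0) r \<subseteq> S"
        using \<open>open S\<close> x0 open_contains_ball by blast
      define t where "t = min e r / 2"
      have t: "0 < t" "t < e" "t < r" using \<open>e > 0\<close> r by (auto simp: t_def)
      have d: "dist (complex_of_real (x0 + t)) (complex_of_real x0) = t"
        using t by (simp add: dist_norm)
      with r t have "complex_of_real (x0 + t) \<in> S \<inter> \<real>"
        by (auto simp: dist_commute simp del: of_real_add)
      with d t show "\<exists>x'\<in>S \<inter> \<real>. x' \<noteq> complex_of_real x0 \<and> dist x' (complex_of_real x0) < e"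
        by (intro bexI[of _ "complex_of_real (x0 + t)"]) auto
    qed
    show "L p (g z) = 0" if "z \<in> S \<inter> \<real>" for z
      using that zero by (auto simp: Reals_def linear_0[OF bounded_linear.linear[OF L]])
  qed (use assms in auto)
  \<comment> \<open>For \<open>p = g w\<close> the real part of \<open>L p (g w)\<close> is the
    squared norm of \<open>g w\<close>.\<close>
  from this[of "g w"] show ?thesis
    by (simp add: L_def complex_eq_iff)
qed

text \<open>As functions on the slice of \<open>j\<close>, both sides have differentials of the form
  \<open>slice_param j h \<odot> d\<close>. On the real axis conjugate points coincide and both
  sides reduce to \<open>f\<close>, so the identity principle gives equality on the whole
  slice.\<close>

lemma slice_representation_formula:
  assumes f: "f \<in> slice_regular \<Omega>" and \<Omega>: "s_domain \<Omega>" "axially_symmetric \<Omega>"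
    and i: "i \<in> imag_sphere" and j: "j \<in> imag_sphere" and xy: "slice_pt i x y \<in> \<Omega>"
  shows "f (slice_pt j x y) = (1/2) *\<^sub>R (f (slice_pt i x y) + f (slice_pt i x (- y))) +
    (1/2) *\<^sub>R (j \<odot> (i \<odot> (f (slice_pt i x (- y)) - f (slice_pt i x y))))"
proof -
  have op: "open \<Omega>" and con: "connected (slice \<Omega> j)"
    using \<Omega> j by (auto simp: s_domain_def)
  \<comment> \<open>By axial symmetry this parameter set is the same for every imaginary unit, so
    the restrictions of \<open>f\<close> along \<open>i\<close>, \<open>- i\<close> and
    \<open>j\<close> share one planar domain.\<close>
  define S where "S = slice_param j -` \<Omega>"
  have S_iff: "z \<in> S \<longleftrightarrow> slice_param k z \<in> \<Omega>" if "k \<in> imag_sphere" for z k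
    using axially_symmetric_slice_pt[OF \<Omega>(2) that j] by (simp add: S_def slice_param_def)
  have "open S"
    unfolding S_def by (intro open_vimage op continuous_on_slice_param)
  have "connected S"
  proof -
    have [simp]: "snd j \<bullet> snd j = 1" "fst j = 0"
      using j by (auto simp: imag_sphere_def norm_prod_def dot_square_norm)
    have inv: "Complex (fst (slice_param j z)) (snd (slice_param j z) \<bullet> snd j) = z" for z
      by (simp add: slice_param_def slice_pt_def qreal_def)
    \<comment> \<open>A continuous left inverse of \<open>slice_param j\<close> maps the slice onto
      \<open>S\<close> and carries its connectedness over.\<close>
    have "S = (\<lambda>q. Complex (fst q) (snd q \<bullet> snd j)) ` slice \<Omega> j"
    proof (intro equalityI subsetI)
      fix z assume "z \<in> S"
      then have "slice_param j z \<in> slice \<Omega> j"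
        by (auto simp: S_def slice_def slice_plane_def slice_param_def)
      then show "z \<in> (\<lambda>q. Complex (fst q) (snd q \<bullet> snd j)) ` slice \<Omega> j"
        by (intro image_eqI[of _ _ "slice_param j z"]) (simp_all only: inv)
    next
      fix z assume "z \<in> (\<lambda>q. Complex (fst q) (snd q \<bullet> snd j)) ` slice \<Omega> j"
      then obtain x y where "slice_pt j x y \<in> \<Omega>"
        "z = Complex (fst (slice_pt j x y)) (snd (slice_pt j x y) \<bullet> snd j)"
        by (auto simp: slice_def slice_plane_def)
      with inv[of "Complex x y"] show "z \<in> S" by (simp add: S_def slice_param_def)
    qed
    then show ?thesis
      using con by (auto simp: Complex_eq intro!: connected_continuous_image continuous_intros)
  qed
  obtain x0 where "qreal x0 \<in> \<Omega>" using \<Omega> by (auto simp: s_domain_def)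
  then have x0: "complex_of_real x0 \<in> S" by (simp add: S_def slice_param_def slice_pt_0)
  define g where "g z = f (slice_param j z) -
    ((1/2) *\<^sub>R (f (slice_param i z) + f (slice_param (- i) z)) +
     (1/2) *\<^sub>R (j \<odot> (i \<odot> (f (slice_param (- i) z) - f (slice_param i z)))))" for z
  have "g (Complex x y) = 0"
  proof (rule slice_identity_principle[OF \<open>open S\<close> \<open>connected S\<close> j _ _ x0])
    fix z assume z: "z \<in> S"
    obtain a b c where
      abc: "((\<lambda>w. f (slice_param i w)) has_derivative (\<lambda>h. slice_param i h \<odot> a)) (at z)"
        "((\<lambda>w. f (slice_param (- i) w)) has_derivative (\<lambda>h. slice_param (- i) h \<odot> b)) (at z)"
        "((\<lambda>w. f (slice_param j w)) has_derivative (\<lambda>h. slice_param j h \<odot> c)) (at z)"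
      using slice_regular_has_derivative[OF f op, of _ z] S_iff[of _ z] z i j uminus_imag_sphere
      by metis
    \<comment> \<open>This is the differential of \<open>g\<close> evaluated at
      \<open>h = 1\<close>. That its value at the imaginary unit is \<open>j \<odot> d\<close>
      follows from \<open>i\<close> and \<open>j\<close> both squaring to -1.\<close>
    define d where "d = c - ((1/2) *\<^sub>R (a + b) + (1/2) *\<^sub>R (j \<odot> (i \<odot> (b - a))))"
    have "(g has_derivative (\<lambda>h. slice_param j h \<odot> c -
        ((1/2) *\<^sub>R (slice_param i h \<odot> a + slice_param (- i) h \<odot> b) +
         (1/2) *\<^sub>R (j \<odot> (i \<odot> (slice_param (- i) h \<odot> b - slice_param i h \<odot> a)))))) (at z)"
      unfolding g_def
      by (intro has_derivative_diff has_derivative_add has_derivative_scaleR_right abc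
          bounded_linear.has_derivative[OF qmult.bounded_linear_right])
    also have "(\<lambda>h. slice_param j h \<odot> c -
        ((1/2) *\<^sub>R (slice_param i h \<odot> a + slice_param (- i) h \<odot> b) +
         (1/2) *\<^sub>R (j \<odot> (i \<odot> (slice_param (- i) h \<odot> b - slice_param i h \<odot> a))))) =
        (\<lambda>h. slice_param j h \<odot> d)"
      by (simp add: fun_eq_iff d_def slice_param_def slice_pt_def qmult.add_left qmult.scaleR_left
          qmult_qreal qmult.add_right qmult.diff_left qmult.diff_right qmult.scaleR_right qmult.minus_left
          qmult.minus_right qmult_imag_sphere_left i j algebra_simps)
    finally show "\<exists>d. (g has_derivative (\<lambda>h. slice_param j h \<odot> d)) (at z)" ..
  next
    show "g (complex_of_real x) = 0" for x
      by (simp add: g_def slice_param_def slice_pt_0 qmult.zero_right flip: scaleR_2)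
    show "Complex x y \<in> S"
      using xy S_iff[OF i] by (simp add: slice_param_def)
  qed
  then show ?thesis
    by (simp add: g_def slice_param_def slice_pt_uminus)
qed

text \<open>Replacing \<open>j\<close> by \<open>- j\<close> only changes the sign of the second
  summand in the representation formula. The parallelogram law then leaves the norms of the two
  summands, in which the units \<open>i\<close> and \<open>j\<close> disappear; a second use of it
  returns to the values on the slice of \<open>i\<close>.\<close>

lemma sum_norm_square_conjugate_points:
  assumes "f \<in> slice_regular \<Omega>" "s_domain \<Omega>" "axially_symmetric \<Omega>"
    and i: "i \<in> imag_sphere" and j: "j \<in> imag_sphere" and "slice_pt i x y \<in> \<Omega>"
  shows "(norm (f (slice_pt j x y)))\<^sup>2 + (norm (f (slice_pt j x (- y))))\<^sup>2 =
    (norm (f (slice_pt i x y)))\<^sup>2 + (norm (f (slice_pt i x (- y))))\<^sup>2"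
proof -
  define a b where "a = f (slice_pt i x y)" and "b = f (slice_pt i x (- y))"
  have par: "(norm (p + q))\<^sup>2 + (norm (p - q))\<^sup>2 = 2 * (norm p)\<^sup>2 + 2 * (norm q)\<^sup>2" for p q :: quat
    by (simp add: power2_norm_eq_inner inner_simps inner_commute)
  have n: "norm i = 1" "norm j = 1" using i j by (auto simp: imag_sphere_def)
  note rep = slice_representation_formula[OF assms(1-4) _ assms(6), folded a_def b_def]
  let ?p = "(1/2) *\<^sub>R (a + b)" and ?q = "(1/2) *\<^sub>R (j \<odot> (i \<odot> (b - a)))"
  have "f (slice_pt j x y) = ?p + ?q"
    by (rule rep[OF j])
  moreover have "f (slice_pt j x (- y)) = ?p - ?q"
    using rep[OF uminus_imag_sphere[OF j]] by (simp add: slice_pt_uminus qmult.minus_left)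
  ultimately have "(norm (f (slice_pt j x y)))\<^sup>2 + (norm (f (slice_pt j x (- y))))\<^sup>2 =
      2 * (norm ?p)\<^sup>2 + 2 * (norm ?q)\<^sup>2"
    by (simp only: par)
  also have "\<dots> = ((norm (a + b))\<^sup>2 + (norm (b - a))\<^sup>2) / 2"
    by (simp add: norm_qmult n power_mult_distrib power_divide)
  also have "\<dots> = (norm a)\<^sup>2 + (norm b)\<^sup>2"
    using par[of b a] by (simp add: add.commute)
  finally show ?thesis by (simp add: a_def b_def)
qed

section \<open>Weighted integrals of a slice regular function\<close>

lemma snd_slice_pt: "snd (slice_pt i x y) = y *\<^sub>R snd i"
  by (simp add: slice_pt_def qreal_def)

lemma norm_snd_slice_pt: "i \<in> imag_sphere \<Longrightarrow> norm (snd (slice_pt i x y)) = \<bar>y\<bar>"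
  by (cases i) (simp add: snd_slice_pt imag_sphere_def norm_Pair del: real_sqrt_eq_1_iff)

text \<open>Nothing controls \<open>f\<close> outside the domain, so only its extension by zero is
  claimed to be measurable.\<close>

lemma slice_regular_measurable:
  assumes "f \<in> slice_regular \<Omega>" and "open \<Omega>"
  shows "(\<lambda>q. indicator \<Omega> q *\<^sub>R f q) \<in> borel_measurable borel"
  using assms
  by (intro borel_measurable_continuous_on_indicator differentiable_imp_continuous_on)
    (auto simp: slice_regular_def)

context
  fixes \<Omega> :: "quat set" and i :: quat and f :: "quat \<Rightarrow> quat"
  assumes ax: "axially_symmetric \<Omega>" and sd: "s_domain \<Omega>"
    and i: "i \<in> imag_sphere" and f: "f \<in> slice_regular \<Omega>"
begin

lemma weighted_measurable:
  fixes w :: "quat \<Rightarrow> real"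
  assumes [measurable]: "w \<in> borel_measurable borel"
  shows "(\<lambda>q. ennreal ((norm (f q))\<^sup>2 * w q) * indicator \<Omega> q) \<in> borel_measurable borel"
proof -
  have [measurable]: "(\<lambda>q. indicator \<Omega> q *\<^sub>R f q) \<in> borel_measurable borel"
    using slice_regular_measurable[OF f] sd by (simp add: s_domain_def)
  have "(\<lambda>q. ennreal ((norm (f q))\<^sup>2 * w q) * indicator \<Omega> q) =
      (\<lambda>q. ennreal ((norm (indicator \<Omega> q *\<^sub>R f q))\<^sup>2 * w q))"
    by (auto split: split_indicator)
  then show ?thesis by (simp only:) measurable
qed

text \<open>A weight in \<open>norm (snd q)\<close> is constant on each sphere around a real point.
  It factors out of the sum over a conjugate pair, which thus stays independent of the imaginary
  unit.\<close>

lemma nn_integral_radial_weight: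
  fixes w :: "real \<Rightarrow> real"
  assumes [measurable]: "w \<in> borel_measurable borel" and w: "\<And>r. w r \<ge> 0"
  shows "(\<integral>\<^sup>+q\<in>\<Omega>. ennreal ((norm (f q))\<^sup>2 * w (norm (snd q))) \<partial>lborel) =
    ennreal (2 * pi) * (\<integral>\<^sup>+x. \<integral>\<^sup>+y. ennreal ((norm (f (slice_pt i x y)))\<^sup>2 * w \<bar>y\<bar>) *
      indicator \<Omega> (slice_pt i x y) * ennreal (y\<^sup>2) \<partial>lborel \<partial>lborel)"
proof -
  define F where "F q = ennreal ((norm (f q))\<^sup>2 * w (norm (snd q))) * indicator \<Omega> q" for q
  have "(\<integral>\<^sup>+q. F q \<partial>lborel) =
      ennreal (2 * pi) * (\<integral>\<^sup>+x. \<integral>\<^sup>+y. F (slice_pt i x y) * ennreal (y\<^sup>2) \<partial>lborel \<partial>lborel)"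
  proof (rule nn_integral_quat_slice)
    have "(\<lambda>q::quat. norm (snd q)) \<in> borel_measurable borel"
      by (intro borel_measurable_continuous_onI continuous_intros)
    then have "(\<lambda>q::quat. w (norm (snd q))) \<in> borel_measurable borel"
      by measurable
    then show "F \<in> borel_measurable borel"
      unfolding F_def[abs_def] by (rule weighted_measurable)
    fix x :: real and v :: "real ^ 3"
    obtain j where j: "j \<in> imag_sphere" and xv: "(x, v) = slice_pt j x (norm v)"
      using exists_slice_pt by blast
    from xv have "v = norm v *\<^sub>R snd j"
      by (metis snd_conv snd_slice_pt)
    with j have xv': "(x, - v) = slice_pt j x (- norm v)"
      by (simp add: slice_pt_def qreal_def prod_eq_iff imag_sphere_def)
    \<comment> \<open>Axial symmetry is applied to \<open>k\<close> and to \<open>- k\<close>, so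
      that the conjugate point is covered as well.\<close>
    have mem: "slice_pt k x y \<in> \<Omega> \<longleftrightarrow> slice_pt i x (norm v) \<in> \<Omega>"
      if "k \<in> imag_sphere" "y = norm v \<or> y = - norm v" for k y
      using that axially_symmetric_slice_pt[OF ax that(1) i, of x "norm v"]
        axially_symmetric_slice_pt[OF ax uminus_imag_sphere[OF that(1)] i, of x "norm v"]
      by (auto simp: slice_pt_uminus)
    have "F (slice_pt j x (norm v)) + F (slice_pt j x (- norm v)) =
        F (slice_pt i x (norm v)) + F (slice_pt i x (- norm v))"
    proof (cases "slice_pt i x (norm v) \<in> \<Omega>")
      case True
      have "F (slice_pt k x (norm v)) + F (slice_pt k x (- norm v)) =
          ennreal (((norm (f (slice_pt k x (norm v))))\<^sup>2 + (norm (f (slice_pt k x (- norm v))))\<^sup>2) *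
            w (norm v))" if "k \<in> imag_sphere" for k
      proof -
        have "slice_pt k x (norm v) \<in> \<Omega>" "slice_pt k x (- norm v) \<in> \<Omega>"
          using True mem[OF that] by blast+
        with that show ?thesis by (simp add: F_def norm_snd_slice_pt w distrib_right)
      qed
      then show ?thesis
        using sum_norm_square_conjugate_points[OF f sd ax i j True] i j by simp
    next
      case False
      then have "slice_pt k x (norm v) \<notin> \<Omega> \<and> slice_pt k x (- norm v) \<notin> \<Omega>"
        if "k \<in> imag_sphere" for k
        using mem[OF that] by blast
      then show ?thesis using i j by (simp add: F_def)
    qed
    then show "F (x, v) + F (x, - v) = F (slice_pt i x (norm v)) + F (slice_pt i x (- norm v))"
      by (simp only: xv' flip: xv)
  qed
  then show ?thesis
    by (simp add: F_def norm_snd_slice_pt[OF i])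
qed

lemma nn_integral_slice_weight:
  fixes w :: "quat \<Rightarrow> real"
  assumes "w \<in> borel_measurable borel"
  shows "(\<integral>\<^sup>+q\<in>slice \<Omega> i. ennreal ((norm (f q))\<^sup>2 * w q) \<partial>slice_measure i) =
    (\<integral>\<^sup>+x. \<integral>\<^sup>+y. ennreal ((norm (f (slice_pt i x y)))\<^sup>2 * w (slice_pt i x y)) *
      indicator \<Omega> (slice_pt i x y) \<partial>lborel \<partial>lborel)"
proof -
  have "closed (slice_plane i)"
  proof -
    have "slice_plane i = slice_param i ` UNIV"
      unfolding slice_plane_def slice_param_def
      by (auto intro: image_eqI[of _ _ "Complex _ _"])
    then show ?thesis
      using closed_subspace linear_subspace_image[OF bounded_linear.linear[OF bounded_linear_slice_param]]
      by (metis subspace_UNIV)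
  qed
  then have [measurable]: "slice_plane i \<in> sets borel" by simp
  note [measurable] = weighted_measurable[OF assms]
  \<comment> \<open>The indicator of the slice is split because that of the plane equals 1 at every
    \<open>slice_pt i x y\<close>; only the indicator of the domain survives.\<close>
  have *: "ennreal ((norm (f q))\<^sup>2 * w q) * indicator (slice \<Omega> i) q =
      ennreal ((norm (f q))\<^sup>2 * w q) * indicator \<Omega> q * indicator (slice_plane i) q" for q
    by (auto simp: slice_def split: split_indicator)
  have plane: "slice_pt i x y \<in> slice_plane i" for x y
    by (auto simp: slice_plane_def)
  show ?thesis
    unfolding * by (subst nn_integral_slice_measure) (simp_all add: plane)
qed

text \<open>For the constant weight 1, the Jacobian factor \<open>y\<^sup>2\<close> of polar
  coordinates is exactly \<open>weight_rho\<close> on the slice.\<close>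

lemma sqnorm_eq_slice: "sqnorm \<Omega> f = ennreal (2 * pi) * sqnorm_slice_rho \<Omega> i f"
proof -
  have [measurable]: "weight_rho \<in> borel_measurable borel"
    unfolding weight_rho_def[abs_def] qIm_def
    by (intro borel_measurable_continuous_onI continuous_intros)
  have "sqnorm_slice_rho \<Omega> i f = (\<integral>\<^sup>+x. \<integral>\<^sup>+y. ennreal ((norm (f (slice_pt i x y)))\<^sup>2) *
      indicator \<Omega> (slice_pt i x y) * ennreal (y\<^sup>2) \<partial>lborel \<partial>lborel)"
    unfolding sqnorm_slice_rho_def
    by (subst nn_integral_slice_weight) (auto simp: weight_rho_slice_pt[OF i] ennreal_mult intro!: nn_integral_cong split: split_indicator)
  then show ?thesis
    using nn_integral_radial_weight[of "\<lambda>_. 1"] by (simp add: sqnorm_def)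
qed

text \<open>Here the weight is the reciprocal of the Jacobian factor, so the slice integral becomes
  unweighted.\<close>

lemma sqnorm_delta_eq_slice: "sqnorm_delta \<Omega> f = ennreal (2 * pi) * sqnorm_slice \<Omega> i f"
proof -
  have "sqnorm_delta \<Omega> f = (\<integral>\<^sup>+q\<in>\<Omega>. ennreal ((norm (f q))\<^sup>2 * (1 / (norm (snd q))\<^sup>2)) \<partial>lborel)"
    by (simp add: sqnorm_delta_def weight_delta_def qIm_def norm_prod_def)
  also have "\<dots> = ennreal (2 * pi) * (\<integral>\<^sup>+x. \<integral>\<^sup>+y. ennreal ((norm (f (slice_pt i x y)))\<^sup>2 * (1 / \<bar>y\<bar>\<^sup>2)) *
      indicator \<Omega> (slice_pt i x y) * ennreal (y\<^sup>2) \<partial>lborel \<partial>lborel)"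
    by (rule nn_integral_radial_weight) simp_all
  \<comment> \<open>The factors cancel except at \<open>y = 0\<close>, where the default value of
    division makes the left integrand 0; for each \<open>x\<close> this is a single point.\<close>
  also have "(\<integral>\<^sup>+x. \<integral>\<^sup>+y. ennreal ((norm (f (slice_pt i x y)))\<^sup>2 * (1 / \<bar>y\<bar>\<^sup>2)) *
      indicator \<Omega> (slice_pt i x y) * ennreal (y\<^sup>2) \<partial>lborel \<partial>lborel) =
      (\<integral>\<^sup>+x. \<integral>\<^sup>+y. ennreal ((norm (f (slice_pt i x y)))\<^sup>2 * 1) *
      indicator \<Omega> (slice_pt i x y) \<partial>lborel \<partial>lborel)"
    by (intro nn_integral_cong nn_integral_cong_AE eventually_mono[OF AE_lborel_singleton[of 0]])
      (auto simp flip: ennreal_mult split: split_indicator)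
  also have "\<dots> = sqnorm_slice \<Omega> i f"
    using nn_integral_slice_weight[of "\<lambda>_. 1"] by (simp add: sqnorm_slice_def)
  finally show ?thesis .
qed

end

theorem proposition5p3:
  fixes \<Omega> :: "quat set" and i :: quat
  assumes "bounded \<Omega>"
    and "axially_symmetric \<Omega>"
    and "s_domain \<Omega>"
    and "i \<in> imag_sphere"
  shows "\<exists>K M K' M' :: real. K > 0 \<and> M > 0 \<and> K' > 0 \<and> M' > 0 \<and>
    (\<forall>f \<in> bergman \<Omega>. sqnorm_slice_rho \<Omega> i f \<le> ennreal K * sqnorm \<Omega> f) \<and>
    (\<forall>f \<in> bergman_slice_rho \<Omega> i. sqnorm \<Omega> f \<le> ennreal M * sqnorm_slice_rho \<Omega> i f) \<and>
    (\<forall>f \<in> bergman_slice \<Omega> i. sqnorm_delta \<Omega> f \<le> ennreal K' * sqnorm_slice \<Omega> i f) \<and>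
    (\<forall>f \<in> bergman_delta \<Omega>. sqnorm_slice \<Omega> i f \<le> ennreal M' * sqnorm_delta \<Omega> f)"
proof (intro exI conjI ballI)
  \<comment> \<open>The witnesses stay open until the four inequalities fix them:
    \<open>2 * pi\<close> in one direction of each identity and its reciprocal in the other. The
    resulting cancellation \<open>c\<close> also covers an infinite \<open>a\<close>.\<close>
  have "ennreal (1 / (2 * pi)) * ennreal (2 * pi) = 1"
    by (subst ennreal_mult[symmetric]) simp_all
  then have c: "ennreal (1 / (2 * pi)) * (ennreal (2 * pi) * a) = a" for a
    by (metis mult.assoc mult_1)
  show "sqnorm_slice_rho \<Omega> i f \<le> ennreal (1 / (2 * pi)) * sqnorm \<Omega> f" if "f \<in> bergman \<Omega>" for f
    using that assms by (simp add: bergman_def sqnorm_eq_slice[of \<Omega> i f] c)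
  show "sqnorm \<Omega> f \<le> ennreal (2 * pi) * sqnorm_slice_rho \<Omega> i f"
    if "f \<in> bergman_slice_rho \<Omega> i" for f
    using that assms by (simp add: bergman_slice_rho_def sqnorm_eq_slice[of \<Omega> i f])
  show "sqnorm_delta \<Omega> f \<le> ennreal (2 * pi) * sqnorm_slice \<Omega> i f"
    if "f \<in> bergman_slice \<Omega> i" for f
    using that assms by (simp add: bergman_slice_def sqnorm_delta_eq_slice[of \<Omega> i f])
  show "sqnorm_slice \<Omega> i f \<le> ennreal (1 / (2 * pi)) * sqnorm_delta \<Omega> f"
    if "f \<in> bergman_delta \<Omega>" for f
    using that assms by (simp add: bergman_delta_def sqnorm_delta_eq_slice[of \<Omega> i f] c)
qed simp_all

end
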